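(* For any $k\in\mathbb{N}=\{0,1,2,\dots\}$, any $j=1,2,\dots,2^k$ and any positive integer $n$, $$\omega_{j,k}^{T(n)}=\frac12\,\omega_{j,k+1}^n+\frac{\omega_{j,k+1}}{2}\,\omega_{3j-1,k+1}^n+\frac12\,\omega_{2^k+j,k+1}^n-\frac{\omega_{j,k+1}}{2}\,\omega_{2^k+3j-1,k+1}^n.$$
   Context: The Collatz map $T$ on positive integers is $T(n)=n/2$ for $n$ even and $T(n)=(3n+1)/2$ for $n$ odd. For any positive integer $m$ and $k\ge0$, $\omega_{m,k}=\exp\left(\frac{(2m-1)\pi i}{2^k}\right)\in\mathbb{C}$, which depends only on $m$ modulo $2^k$; for $m=1,\dots,2^k$ these are the $2^k$-th roots of $-1$. *)

theory Defs imports Complex_Main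
begin

definition collatz :: "nat \<Rightarrow> nat" where
  "collatz n = (if even n then n div 2 else (3 * n + 1) div 2)"

(* Intended for m \<ge> 1; the subtraction is taken in the reals, so it does not truncate. *)
definition omega :: "nat \<Rightarrow> nat \<Rightarrow> complex" where
  "omega m k = exp (complex_of_real ((2 * real m - 1) * pi / 2 ^ k) * \<i>)"

end

theory Submission imports Defs
begin

text \<open>
  Put \<open>w = omega j (k + 1)\<close>. Every root of unity in the statement is, up to sign, a power of
  \<open>w\<close>: halving the angle of \<open>omega j k\<close> gives \<open>w\<close> (\<open>omega_Suc_square\<close>), the index \<open>3 * j - 1\<close> triples
  the odd number \<open>2 * j - 1\<close> and so gives \<open>w ^ 3\<close> (\<open>omega_triple\<close>), and shifting the index by half
  the period \<open>2 ^ (k + 1)\<close> changes the sign (\<open>omega_half_period\<close>). The right-hand side is therefore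
  \<open>w ^ n * (1 + (- 1) ^ n) / 2 + w ^ (3 * n + 1) * (1 - (- 1) ^ n) / 2\<close>.
  The two parity projections select \<open>w ^ n\<close> for even \<open>n\<close> and \<open>w ^ (3 * n + 1)\<close> for odd \<open>n\<close>,
  which in both cases is \<open>w ^ (2 * collatz n)\<close>.
\<close>

lemma omega_Suc_square: "omega m (Suc k) ^ 2 = omega m k"
proof -
  have "of_nat 2 * (complex_of_real ((2 * real m - 1) * pi / 2 ^ Suc k) * \<i>)
      = complex_of_real ((2 * real m - 1) * pi / 2 ^ k) * \<i>"
    by simp
  then show ?thesis
    unfolding omega_def by (simp only: exp_of_nat_mult [symmetric])
qed

lemma omega_triple:
  assumes "m \<ge> 1"
  shows "omega (3 * m - 1) k = omega m k ^ 3"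
proof -
  have "2 * real (3 * m - 1) - 1 = 3 * (2 * real m - 1)"
    using assms by (simp add: of_nat_diff)
  then have "complex_of_real ((2 * real (3 * m - 1) - 1) * pi / 2 ^ k) * \<i>
      = of_nat 3 * (complex_of_real ((2 * real m - 1) * pi / 2 ^ k) * \<i>)"
    by (simp only:) simp
  then show ?thesis
    unfolding omega_def by (simp only: exp_of_nat_mult [symmetric])
qed

lemma omega_half_period: "omega (2 ^ k + m) (Suc k) = - omega m (Suc k)"
proof -
  have "(2 * real (2 ^ k + m) - 1) * pi / 2 ^ Suc k = (2 * real m - 1) * pi / 2 ^ Suc k + pi"
    by (simp add: field_simps)
  then show ?thesis
    unfolding omega_def by (simp only: of_real_add distrib_right exp_add) simp
qed

lemma double_collatz: "2 * collatz n = (if even n then n else 3 * n + 1)"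
  by (simp add: collatz_def)

theorem theorem7p7:
  fixes k j n :: nat
  assumes "j \<in> {1..2 ^ k}" and "n > 0"
  shows "omega j k ^ collatz n =
    1 / 2 * omega j (k + 1) ^ n
    + omega j (k + 1) / 2 * omega (3 * j - 1) (k + 1) ^ n
    + 1 / 2 * omega (2 ^ k + j) (k + 1) ^ n
    - omega j (k + 1) / 2 * omega (2 ^ k + 3 * j - 1) (k + 1) ^ n"
proof -
  define w where "w = omega j (k + 1)"
  have j: "j \<ge> 1"
    using assms(1) by simp
  have triple: "omega (3 * j - 1) (k + 1) = w ^ 3"
    using omega_triple [OF j] by (simp add: w_def)
  have shift: "omega (2 ^ k + j) (k + 1) = - w"
    by (simp add: omega_half_period w_def)
  have "2 ^ k + 3 * j - 1 = 2 ^ k + (3 * j - 1)"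
    using j by simp
  then have shift_triple: "omega (2 ^ k + 3 * j - 1) (k + 1) = - (w ^ 3)"
    using omega_half_period [of k "3 * j - 1"] triple by simp
  have "omega j k ^ collatz n = w ^ (2 * collatz n)"
    by (simp add: w_def power_mult omega_Suc_square)
  also have "\<dots> = (if even n then w ^ n else w * (w ^ 3) ^ n)"
    by (simp add: double_collatz power_mult)
  also have "\<dots> = 1 / 2 * w ^ n + w / 2 * (w ^ 3) ^ n + 1 / 2 * (- w) ^ n - w / 2 * (- (w ^ 3)) ^ n"
    by simp
  finally show ?thesis
    by (simp only: triple shift shift_triple w_def [symmetric])
qed

end
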